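(* Let $\Omega\subset\mathbb{C}$ be simply connected and compact, let $F:\Omega\to\mathbb{C}$ be an arbitrary function, let $N\ge 0$ be an integer, and let $Z=\{z_j\}_{j=0,1,\dots,N}\subset\Omega$ be a set of $N+1$ distinct points. Let $V^{(N)}\in\mathbb{C}^{(N+1)\times(N+1)}$ be the Vandermonde matrix with entries $V^{(N)}_{jk}=z_j^k$ ($0\le j,k\le N$), let $f^{(N)}=(F(z_0),F(z_1),\dots,F(z_N))^T$, let $a^{(N)}=(a_0,a_1,\dots,a_N)^T$ be the solution of $V^{(N)}a^{(N)}=f^{(N)}$, and let $P_N(z)=\sum_{k=0}^N a_kz^k$ be the interpolating polynomial of $F$ for $Z$. Let $u>0$ (machine epsilon). Suppose that there exists a constant $\gamma_N\ge 0$ such that the vector $\widehat a^{(N)}=(\widehat a_0,\widehat a_1,\dots,\widehat a_N)^T\in\mathbb{C}^{N+1}$ (the computed monomial coefficient vector) satisfies $$\bigl(V^{(N)}+\delta V^{(N)}\bigr)\widehat a^{(N)}=f^{(N)}$$ for some $\delta V^{(N)}\in\mathbb{C}^{(N+1)\times(N+1)}$ with $$\lVert\delta V^{(N)}\rVert_2\le u\cdot\gamma_N.$$ Let $\widehat P_N(z):=\sum_{k=0}^N\widehat a_kz^k$. Then $$\lVert F-\widehat P_N\rVert_{L^\infty(\Omega)}\le\lVert F-P_N\rVert_{L^\infty(\Omega)}+u\cdot\gamma_N\Lambda_N\lVert\widehat a^{(N)}\rVert_2,$$ where $\Lambda_N$ is the Lebesgue constant for $Z$ over $\Omega$. If, in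 addition, $$\lVert(V^{(N)})^{-1}\rVert_2\le\frac{1}{2u\cdot\gamma_N},$$ then $$\frac23\lVert a^{(N)}\rVert_2\le\lVert\widehat a^{(N)}\rVert_2\le 2\lVert a^{(N)}\rVert_2,$$ and $$\lVert F-\widehat P_N\rVert_{L^\infty(\Omega)}\le\lVert F-P_N\rVert_{L^\infty(\Omega)}+2u\cdot\gamma_N\Lambda_N\lVert a^{(N)}\rVert_2.$$
   Context: $\lVert\cdot\rVert_2$ is the Euclidean norm on vectors and the induced operator norm on matrices. $\lVert g\rVert_{L^\infty(\Omega)}=\sup_{z\in\Omega}|g(z)|$ (possibly $+\infty$). The Lebesgue constant for the interpolation points $Z=\{z_j\}_{j=0}^N\subset\Omega$ is $$\Lambda_N:=\sup_{G\in C(\Omega),\,G\ne 0}\frac{\lVert P_N[G]\rVert_{L^\infty(\Omega)}}{\lVert G\rVert_{L^\infty(\Omega)}},$$ where $P_N[G]$ is the polynomial of degree at most $N$ with $P_N[G](z_j)=G(z_j)$ for $j=0,\dots,N$. When $\gamma_N=0$, the quantity $1/(2u\cdot\gamma_N)$ is read as $+\infty$. *)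

theory Defs
  imports
    "HOL-Analysis.Analysis"
    "HOL-Computational_Algebra.Polynomial"
    "Jordan_Normal_Form.Gauss_Jordan_Elimination"
begin

text \<open>
  The dimension \<open>N + 1\<close> is an ordinary natural number, so vectors and matrices are the
  carrier-based, 0-indexed ones of Jordan_Normal_Form; the indexing operator of the Analysis
  vector type is switched off.
\<close>

no_notation Finite_Cartesian_Product.vec_nth (infixl "$" 90)

definition vec_norm2 :: "complex vec \<Rightarrow> real" where
  "vec_norm2 v = L2_set (\<lambda>i. cmod (v $ i)) {..<dim_vec v}"

text \<open>
  As in the library definition of \<open>onorm\<close>, the zero vector is allowed in the supremum and
  contributes \<open>0 / 0 = 0\<close>.  The set of quotients is bounded above, so the real supremum is
  the true one.
\<close>

definition mat_norm2 :: "complex mat \<Rightarrow> real" where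
  "mat_norm2 A = (SUP x\<in>carrier_vec (dim_col A). vec_norm2 (A *\<^sub>v x) / vec_norm2 x)"

definition vandermonde :: "nat \<Rightarrow> (nat \<Rightarrow> complex) \<Rightarrow> complex mat" where
  "vandermonde N z = mat (N + 1) (N + 1) (\<lambda>(j, k). z j ^ k)"

definition sample_vec :: "nat \<Rightarrow> (nat \<Rightarrow> complex) \<Rightarrow> (complex \<Rightarrow> complex) \<Rightarrow> complex vec" where
  "sample_vec N z F = vec (N + 1) (\<lambda>j. F (z j))"

definition monomial_expansion :: "complex vec \<Rightarrow> complex \<Rightarrow> complex" where
  "monomial_expansion a w = (\<Sum>k<dim_vec a. a $ k * w ^ k)"

definition Linf_norm :: "complex set \<Rightarrow> (complex \<Rightarrow> complex) \<Rightarrow> ennreal" where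
  "Linf_norm \<Omega> g = (SUP w\<in>\<Omega>. ennreal (cmod (g w)))"

definition interp_poly :: "nat \<Rightarrow> (nat \<Rightarrow> complex) \<Rightarrow> (complex \<Rightarrow> complex) \<Rightarrow> complex poly" where
  "interp_poly N z G = (THE p. degree p \<le> N \<and> (\<forall>j\<le>N. poly p (z j) = G (z j)))"

text \<open>
  Functions are total in HOL: membership in \<open>C(\<Omega>)\<close> and being nonzero refer only to the
  values on \<open>\<Omega>\<close>.
\<close>

definition lebesgue_constant :: "complex set \<Rightarrow> nat \<Rightarrow> (nat \<Rightarrow> complex) \<Rightarrow> ennreal" where
  "lebesgue_constant \<Omega> N z =
     (SUP G\<in>{G. continuous_on \<Omega> G \<and> (\<exists>w\<in>\<Omega>. G w \<noteq> 0)}.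
        Linf_norm \<Omega> (poly (interp_poly N z G)) / Linf_norm \<Omega> G)"

end

theory Submission
  imports Defs "Jordan_Normal_Form.Determinant"
begin

text \<open>
  At the nodes, \<open>P\<^sub>N\<close> minus the computed polynomial takes the values \<open>h = \<delta>V a_hat\<close>.  Tietze's theorem
  extends these values to a continuous \<open>G\<close> on \<open>\<Omega>\<close> with sup norm at most
  \<open>\<parallel>h\<parallel>\<^sub>2 \<le> u \<gamma> \<parallel>a_hat\<parallel>\<^sub>2\<close>, and since the difference is the interpolant of \<open>G\<close>, its sup norm is at
  most \<open>\<Lambda>\<^sub>N u \<gamma> \<parallel>a_hat\<parallel>\<^sub>2\<close>.  The coefficients satisfy \<open>a - a_hat = V\<^sup>-\<^sup>1 \<delta>V a_hat\<close>, so the condition on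
  \<open>V\<^sup>-\<^sup>1\<close> gives \<open>\<parallel>a - a_hat\<parallel>\<^sub>2 \<le> \<parallel>a_hat\<parallel>\<^sub>2 / 2\<close>.
\<close>

section \<open>Euclidean vector norm and the induced matrix norm\<close>

lemma vec_norm2_nonneg [simp]: "0 \<le> vec_norm2 v"
  by (simp add: vec_norm2_def)

lemma norm_vec_index_le_vec_norm2: "i < dim_vec v \<Longrightarrow> cmod (v $ i) \<le> vec_norm2 v"
  unfolding vec_norm2_def by (rule member_le_L2_set) auto

lemma vec_norm2_triangle:
  assumes "v \<in> carrier_vec n" "w \<in> carrier_vec n"
  shows "vec_norm2 (v + w) \<le> vec_norm2 v + vec_norm2 w"
proof -
  have "vec_norm2 (v + w) \<le> L2_set (\<lambda>i. cmod (v $ i) + cmod (w $ i)) {..<n}"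
    using assms unfolding vec_norm2_def
    by (auto intro!: L2_set_mono norm_triangle_ineq)
  also have "\<dots> \<le> vec_norm2 v + vec_norm2 w"
    using assms unfolding vec_norm2_def by (auto intro!: L2_set_triangle_ineq)
  finally show ?thesis .
qed

lemma vec_norm2_minus_commute:
  assumes "v \<in> carrier_vec n" "w \<in> carrier_vec n"
  shows "vec_norm2 (v - w) = vec_norm2 (w - v)"
  using assms unfolding vec_norm2_def
  by (auto intro!: L2_set_cong simp: norm_minus_commute)

lemma vec_norm2_le_add_diff:
  assumes "v \<in> carrier_vec n" "w \<in> carrier_vec n"
  shows "vec_norm2 v \<le> vec_norm2 w + vec_norm2 (v - w)"
proof -
  have "v = w + (v - w)"
    using assms by (intro eq_vecI) auto
  then show ?thesis
    using vec_norm2_triangle[of w n "v - w"] assms by simp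
qed

text \<open>A crude bound by the sum of all entries. It makes the quotients in
  \<open>mat_norm2\<close> bounded above, without which their real supremum carries no
  information.\<close>

lemma vec_norm2_mult_mat_vec_le_sum:
  assumes "A \<in> carrier_mat m n" "x \<in> carrier_vec n"
  shows "vec_norm2 (A *\<^sub>v x) \<le> (\<Sum>i<m. \<Sum>j<n. cmod (A $$ (i, j))) * vec_norm2 x"
proof -
  have "cmod ((A *\<^sub>v x) $ i) \<le> (\<Sum>j<n. cmod (A $$ (i, j))) * vec_norm2 x" if "i < m" for i
  proof -
    have "(A *\<^sub>v x) $ i = (\<Sum>j<n. A $$ (i, j) * x $ j)"
      using assms that by (simp add: scalar_prod_def atLeast0LessThan)
    also have "cmod \<dots> \<le> (\<Sum>j<n. cmod (A $$ (i, j) * x $ j))"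
      by (rule norm_sum)
    also have "\<dots> \<le> (\<Sum>j<n. cmod (A $$ (i, j)) * vec_norm2 x)"
      using assms
      by (intro sum_mono) (auto simp: norm_mult intro!: mult_left_mono norm_vec_index_le_vec_norm2)
    finally show ?thesis
      by (simp add: sum_distrib_right)
  qed
  then have "(\<Sum>i<m. cmod ((A *\<^sub>v x) $ i))
      \<le> (\<Sum>i<m. \<Sum>j<n. cmod (A $$ (i, j))) * vec_norm2 x"
    unfolding sum_distrib_right[of _ "{..<m}"] by (intro sum_mono) auto
  moreover have "vec_norm2 (A *\<^sub>v x) \<le> (\<Sum>i<m. cmod ((A *\<^sub>v x) $ i))"
    using assms L2_set_le_sum[of "{..<m}" "\<lambda>i. cmod ((A *\<^sub>v x) $ i)"]
    by (simp add: vec_norm2_def)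
  ultimately show ?thesis
    by linarith
qed

lemma vec_norm2_mult_mat_vec_le:
  assumes A: "A \<in> carrier_mat m n" and x: "x \<in> carrier_vec n"
  shows "vec_norm2 (A *\<^sub>v x) \<le> mat_norm2 A * vec_norm2 x"
\<comment> \<open>A vector of norm 0 contributes only the quotient 0 / 0 = 0, so here the crude
  bound is what forces \<open>A *\<^sub>v x\<close> to have norm 0.\<close>
proof (cases "vec_norm2 x = 0")
  case True
  then show ?thesis
    using vec_norm2_mult_mat_vec_le_sum[OF A x] by simp
next
  case False
  then have pos: "0 < vec_norm2 x"
    by (simp add: order_less_le)
  let ?C = "\<Sum>i<m. \<Sum>j<n. cmod (A $$ (i, j))"
  have "0 \<le> ?C"
    by (intro sum_nonneg) auto
  then have "vec_norm2 (A *\<^sub>v y) / vec_norm2 y \<le> ?C" if "y \<in> carrier_vec n" for y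
    using vec_norm2_mult_mat_vec_le_sum[OF A that]
    by (cases "vec_norm2 y = 0") (auto simp: divide_le_eq order_less_le)
  then have "bdd_above ((\<lambda>y. vec_norm2 (A *\<^sub>v y) / vec_norm2 y) ` carrier_vec n)"
    by (auto intro!: bdd_aboveI2)
  then have "vec_norm2 (A *\<^sub>v x) / vec_norm2 x \<le> mat_norm2 A"
    using A x unfolding mat_norm2_def by (auto intro!: cSUP_upper)
  then show ?thesis
    using pos by (simp add: divide_le_eq)
qed

section \<open>Interpolation at distinct nodes and the Vandermonde matrix\<close>

lemma degree_monomial_sum_le: "degree (\<Sum>k<Suc N. monom (c k) k) \<le> N"
  by (intro degree_sum_le) (auto intro: order_trans[OF degree_monom_le])

lemma monomial_expansion_eq_poly:
  "monomial_expansion a w = poly (\<Sum>k<dim_vec a. monom (a $ k) k) w"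
  by (simp add: monomial_expansion_def poly_sum poly_monom)

lemma monomial_expansion_minus:
  assumes "a \<in> carrier_vec n" "b \<in> carrier_vec n"
  shows "monomial_expansion (a - b) w = monomial_expansion a w - monomial_expansion b w"
  using assms by (simp add: monomial_expansion_def left_diff_distrib sum_subtractf)

lemma vandermonde_carrier [simp]: "vandermonde N z \<in> carrier_mat (N + 1) (N + 1)"
  by (simp add: vandermonde_def)

lemma vandermonde_mult_vec_index:
  assumes "a \<in> carrier_vec (N + 1)" "j \<le> N"
  shows "(vandermonde N z *\<^sub>v a) $ j = monomial_expansion a (z j)"
  using assms
  by (simp add: vandermonde_def monomial_expansion_def scalar_prod_def atLeast0LessThan
      mult.commute)

lemma poly_eqI_nodes:
  fixes p q :: "complex poly"
  assumes inj: "inj_on z {0..N}" and "degree p \<le> N" "degree q \<le> N"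
    and "\<And>j. j \<le> N \<Longrightarrow> poly p (z j) = poly q (z j)"
  shows "p = q"
proof (rule poly_eqI_degree)
  show "poly p x = poly q x" if "x \<in> z ` {0..N}" for x
    using that assms(4) by auto
  have "card (z ` {0..N}) = Suc N"
    using inj by (simp add: card_image)
  then show "card (z ` {0..N}) > degree p" "card (z ` {0..N}) > degree q"
    using assms(2,3) by auto
qed

text \<open>Evaluates the definite description: \<open>p\<close> itself witnesses existence, and N +
  1 distinct nodes determine a polynomial of degree at most N.\<close>

lemma interp_poly_eqI:
  assumes "inj_on z {0..N}" "degree p \<le> N" "\<And>j. j \<le> N \<Longrightarrow> poly p (z j) = G (z j)"
  shows "interp_poly N z G = p"
  unfolding interp_poly_def
  by (rule the_equality) (use assms in \<open>auto intro: poly_eqI_nodes\<close>)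

text \<open>A nonzero kernel vector would be the coefficient vector of a nonzero polynomial of
  degree at most N that vanishes at N + 1 distinct nodes.\<close>

lemma det_vandermonde_nonzero:
  assumes inj: "inj_on z {0..N}"
  shows "det (vandermonde N z) \<noteq> 0"
proof
  assume "det (vandermonde N z) = 0"
  then obtain v where v: "v \<in> carrier_vec (N + 1)" "v \<noteq> 0\<^sub>v (N + 1)"
    and Vv: "vandermonde N z *\<^sub>v v = 0\<^sub>v (N + 1)"
    using det_0_iff_vec_prod_zero_field[OF vandermonde_carrier] by blast
  let ?p = "\<Sum>k<Suc N. monom (v $ k) k"
  have "?p = 0"
  proof (rule poly_eqI_nodes[OF inj])
    show "poly ?p (z j) = poly 0 (z j)" if "j \<le> N" for j
      using vandermonde_mult_vec_index[OF v(1) that, of z] that v(1)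
      unfolding Vv monomial_expansion_eq_poly by simp
  qed (auto intro!: degree_monomial_sum_le simp del: sum.lessThan_Suc)
  have "v = 0\<^sub>v (N + 1)"
  proof (rule eq_vecI)
    fix k assume "k < dim_vec (0\<^sub>v (N + 1) :: complex vec)"
    then have "k < Suc N" by simp
    then have "poly.coeff ?p k = v $ k"
      by (simp add: coeff_sum coeff_monom sum.delta del: sum.lessThan_Suc)
    with \<open>?p = 0\<close> \<open>k < Suc N\<close> show "v $ k = 0\<^sub>v (N + 1) $ k" by simp
  qed (use v in auto)
  with v show False by simp
qed

text \<open>\<open>mat_inverse\<close> returns an option. The nonzero determinant excludes
  \<open>None\<close>, so \<open>the\<close> yields a genuine inverse.\<close>

lemma vandermonde_mat_inverse:
  assumes "inj_on z {0..N}"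
  shows "the (mat_inverse (vandermonde N z)) \<in> carrier_mat (N + 1) (N + 1)"
    and "the (mat_inverse (vandermonde N z)) * vandermonde N z = 1\<^sub>m (N + 1)"
proof -
  have "vandermonde N z \<in> Units (ring_mat TYPE(complex) (N + 1) ())"
    using det_non_zero_imp_unit[OF vandermonde_carrier det_vandermonde_nonzero[OF assms]] .
  then obtain B where "mat_inverse (vandermonde N z) = Some B"
    using mat_inverse(1)[OF vandermonde_carrier] by fastforce
  then show "the (mat_inverse (vandermonde N z)) \<in> carrier_mat (N + 1) (N + 1)"
    and "the (mat_inverse (vandermonde N z)) * vandermonde N z = 1\<^sub>m (N + 1)"
    using mat_inverse(2)[OF vandermonde_carrier] by auto
qed

section \<open>Sup norm over \<Omega> and the Lebesgue constant\<close>

lemma Linf_norm_add_le: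
  "Linf_norm \<Omega> (\<lambda>w. f w + g w) \<le> Linf_norm \<Omega> f + Linf_norm \<Omega> g"
  unfolding Linf_norm_def
proof (rule SUP_least)
  fix w assume "w \<in> \<Omega>"
  have "ennreal (cmod (f w + g w)) \<le> ennreal (cmod (f w)) + ennreal (cmod (g w))"
    by (simp flip: ennreal_plus add: norm_triangle_ineq)
  also have "\<dots> \<le> (SUP w\<in>\<Omega>. ennreal (cmod (f w))) + (SUP w\<in>\<Omega>. ennreal (cmod (g w)))"
    using \<open>w \<in> \<Omega>\<close> by (intro add_mono SUP_upper)
  finally show "ennreal (cmod (f w + g w)) \<le> \<dots>" .
qed

text \<open>The quotient for \<open>G\<close> is among those in the supremum. Clearing its
  denominator in \<open>ennreal\<close> requires \<open>Linf_norm \<Omega> G\<close> to be neither 0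
  nor infinite.\<close>

lemma Linf_norm_interp_poly_le:
  assumes "continuous_on \<Omega> G" "w \<in> \<Omega>" "G w \<noteq> 0" "Linf_norm \<Omega> G < \<infinity>"
  shows "Linf_norm \<Omega> (poly (interp_poly N z G)) \<le> lebesgue_constant \<Omega> N z * Linf_norm \<Omega> G"
proof -
  have "0 < ennreal (cmod (G w))"
    using assms by simp
  also have "\<dots> \<le> Linf_norm \<Omega> G"
    unfolding Linf_norm_def using assms by (intro SUP_upper)
  finally have nz: "Linf_norm \<Omega> G \<noteq> 0" by simp
  have "Linf_norm \<Omega> (poly (interp_poly N z G))
      = Linf_norm \<Omega> (poly (interp_poly N z G)) / Linf_norm \<Omega> G * Linf_norm \<Omega> G"
    using nz assms(4) by (simp add: ennreal_divide_times)
  also have "\<dots> \<le> lebesgue_constant \<Omega> N z * Linf_norm \<Omega> G"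
    unfolding lebesgue_constant_def
    by (intro mult_right_mono SUP_upper) (use assms in auto)
  finally show ?thesis .
qed

text \<open>The bound \<open>M\<close> is known only at the nodes, whereas the Lebesgue constant
  compares with a norm over all of \<Omega>. Interpolation sees only node values, so
  \<open>p\<close> may be replaced by a function that stays below \<open>M\<close>
  everywhere.\<close>

lemma Linf_norm_poly_le_lebesgue_constant:
  assumes z: "z ` {0..N} \<subseteq> \<Omega>" and inj: "inj_on z {0..N}"
    and deg: "degree p \<le> N" and "0 \<le> M"
    and bound: "\<And>j. j \<le> N \<Longrightarrow> cmod (poly p (z j)) \<le> M"
  shows "Linf_norm \<Omega> (poly p) \<le> lebesgue_constant \<Omega> N z * ennreal M"
proof (cases "p = 0")
  case True
  then show ?thesis
    by (cases "\<Omega> = {}") (auto simp: Linf_norm_def bot_ennreal)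
next
  case False
  \<comment> \<open>A nonzero \<open>p\<close> of degree at most N cannot vanish at all nodes. This
    node makes the extension \<open>G\<close> nonzero, as the supremum demands.\<close>
  then obtain j where j: "j \<le> N" "poly p (z j) \<noteq> 0"
    using poly_eqI_nodes[OF inj deg, of 0] by auto
  have closed: "closedin (top_of_set \<Omega>) (z ` {0..N})"
    using z by (auto intro: closed_subset finite_imp_closed)
  obtain G where G: "continuous_on \<Omega> G"
      "\<And>x. x \<in> z ` {0..N} \<Longrightarrow> G x = poly p x" "\<And>x. x \<in> \<Omega> \<Longrightarrow> cmod (G x) \<le> M"
  \<comment> \<open>The extension keeps the same bound \<open>M\<close>, so no constant is
    lost.\<close>
  proof (rule Tietze[OF _ closed \<open>0 \<le> M\<close>, of "poly p"])
    show "continuous_on (z ` {0..N}) (poly p)"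
      by (intro continuous_intros)
    show "cmod (poly p x) \<le> M" if "x \<in> z ` {0..N}" for x
      using that bound by auto
  qed auto
  have GM: "Linf_norm \<Omega> G \<le> ennreal M"
    unfolding Linf_norm_def using G(3) by (auto intro!: SUP_least ennreal_leI)
  have "Linf_norm \<Omega> (poly p) = Linf_norm \<Omega> (poly (interp_poly N z G))"
    using G(2) by (subst interp_poly_eqI[OF inj deg]) auto
  also have "\<dots> \<le> lebesgue_constant \<Omega> N z * Linf_norm \<Omega> G"
    using G j z GM
    by (intro Linf_norm_interp_poly_le[of \<Omega> G "z j"])
      (auto intro: le_less_trans[of _ "ennreal M"])
  also have "\<dots> \<le> lebesgue_constant \<Omega> N z * ennreal M"
    using GM by (rule mult_left_mono) simp
  finally show ?thesis .
qed

theorem theorem2p2: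
  fixes \<Omega> :: "complex set" and F :: "complex \<Rightarrow> complex" and N :: nat
    and z :: "nat \<Rightarrow> complex" and a a_hat :: "complex vec"
    and \<delta>V :: "complex mat" and u \<gamma> :: real
  assumes "simply_connected \<Omega>" and "compact \<Omega>"
    and "z ` {0..N} \<subseteq> \<Omega>" and "inj_on z {0..N}"
    and "a \<in> carrier_vec (N + 1)"
    and "vandermonde N z *\<^sub>v a = sample_vec N z F"
    and "u > 0" and "\<gamma> \<ge> 0"
    and "a_hat \<in> carrier_vec (N + 1)"
    and "\<delta>V \<in> carrier_mat (N + 1) (N + 1)"
    and "(vandermonde N z + \<delta>V) *\<^sub>v a_hat = sample_vec N z F"
    and "mat_norm2 \<delta>V \<le> u * \<gamma>"
  shows "Linf_norm \<Omega> (\<lambda>w. F w - monomial_expansion a_hat w)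
           \<le> Linf_norm \<Omega> (\<lambda>w. F w - monomial_expansion a w)
             + ennreal (u * \<gamma>) * lebesgue_constant \<Omega> N z * ennreal (vec_norm2 a_hat)
       \<and> (ennreal (mat_norm2 (the (mat_inverse (vandermonde N z)))) \<le> 1 / ennreal (2 * u * \<gamma>)
          \<longrightarrow> 2 / 3 * vec_norm2 a \<le> vec_norm2 a_hat
            \<and> vec_norm2 a_hat \<le> 2 * vec_norm2 a
            \<and> Linf_norm \<Omega> (\<lambda>w. F w - monomial_expansion a_hat w)
                \<le> Linf_norm \<Omega> (\<lambda>w. F w - monomial_expansion a w)
                  + ennreal (2 * u * \<gamma>) * lebesgue_constant \<Omega> N z * ennreal (vec_norm2 a))"
proof -
  let ?V = "vandermonde N z" and ?W = "the (mat_inverse (vandermonde N z))"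
  let ?h = "\<delta>V *\<^sub>v a_hat" and ?\<Lambda> = "lebesgue_constant \<Omega> N z"
  let ?p = "\<Sum>k<Suc N. monom ((a - a_hat) $ k) k"
  note a = \<open>a \<in> carrier_vec (N + 1)\<close> and a_hat = \<open>a_hat \<in> carrier_vec (N + 1)\<close>
    and \<delta>V = \<open>\<delta>V \<in> carrier_mat (N + 1) (N + 1)\<close>
    and z = \<open>z ` {0..N} \<subseteq> \<Omega>\<close> and inj = \<open>inj_on z {0..N}\<close>
  have u\<gamma>: "0 \<le> u * \<gamma>"
    using \<open>u > 0\<close> \<open>\<gamma> \<ge> 0\<close> by simp
  have h: "?h \<in> carrier_vec (N + 1)"
    using \<delta>V a_hat by simp
  \<comment> \<open>The exact and the perturbed system share the right-hand side.\<close>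
  have "?V *\<^sub>v a = ?V *\<^sub>v a_hat + ?h"
    using assms(6,11) add_mult_distrib_mat_vec[OF vandermonde_carrier \<delta>V a_hat] by simp
  then have Vdiff: "?V *\<^sub>v (a - a_hat) = ?h"
    using mult_minus_distrib_mat_vec[OF vandermonde_carrier a a_hat] \<delta>V a_hat
    by (auto simp: vandermonde_def)
  have h_le: "vec_norm2 ?h \<le> u * \<gamma> * vec_norm2 a_hat"
    using vec_norm2_mult_mat_vec_le[OF \<delta>V a_hat] assms(12)
    by (meson mult_right_mono order_trans vec_norm2_nonneg)
  \<comment> \<open>\<open>?p\<close> is the exact interpolant minus the computed one.\<close>
  have p: "poly ?p w = monomial_expansion a w - monomial_expansion a_hat w" for w
    using monomial_expansion_minus[OF a a_hat] monomial_expansion_eq_poly[of "a - a_hat"] a_hat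
    by simp
  have "cmod (poly ?p (z j)) \<le> u * \<gamma> * vec_norm2 a_hat" if "j \<le> N" for j
  proof -
    have "poly ?p (z j) = ?h $ j"
      using vandermonde_mult_vec_index[of "a - a_hat" N j z] a a_hat that
      unfolding p Vdiff by (simp add: monomial_expansion_minus)
    then show ?thesis
      using norm_vec_index_le_vec_norm2[of j ?h] h h_le that
      by (metis Suc_eq_plus1 carrier_vecD less_Suc_eq_le order_trans)
  qed
  then have "Linf_norm \<Omega> (poly ?p) \<le> ?\<Lambda> * ennreal (u * \<gamma> * vec_norm2 a_hat)"
    using u\<gamma> by (intro Linf_norm_poly_le_lebesgue_constant[OF z inj])
      (auto intro!: degree_monomial_sum_le simp del: sum.lessThan_Suc)
  also have "\<dots> = ennreal (u * \<gamma>) * ?\<Lambda> * ennreal (vec_norm2 a_hat)"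
    by (subst ennreal_mult) (use u\<gamma> in \<open>simp_all add: mult_ac\<close>)
  finally have "Linf_norm \<Omega> (poly ?p) \<le> ennreal (u * \<gamma>) * ?\<Lambda> * ennreal (vec_norm2 a_hat)" .
  then have first: "Linf_norm \<Omega> (\<lambda>w. F w - monomial_expansion a_hat w)
      \<le> Linf_norm \<Omega> (\<lambda>w. F w - monomial_expansion a w)
        + ennreal (u * \<gamma>) * ?\<Lambda> * ennreal (vec_norm2 a_hat)"
    using Linf_norm_add_le[of \<Omega> "\<lambda>w. F w - monomial_expansion a w" "poly ?p"]
    unfolding p by (auto intro: order_trans add_left_mono)
  have second: "2 / 3 * vec_norm2 a \<le> vec_norm2 a_hat
      \<and> vec_norm2 a_hat \<le> 2 * vec_norm2 a
      \<and> Linf_norm \<Omega> (\<lambda>w. F w - monomial_expansion a_hat w)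
          \<le> Linf_norm \<Omega> (\<lambda>w. F w - monomial_expansion a w)
            + ennreal (2 * u * \<gamma>) * ?\<Lambda> * ennreal (vec_norm2 a)"
    if cond: "ennreal (mat_norm2 ?W) \<le> 1 / ennreal (2 * u * \<gamma>)"
  proof -
    have half: "mat_norm2 ?W * (u * \<gamma>) \<le> 1 / 2"
    \<comment> \<open>For \<gamma> = 0 the condition has an infinite right-hand side, but the
      product to be bounded is 0. Otherwise the condition transfers to the reals.\<close>
    proof (cases "\<gamma> = 0")
      case False
      then have pos: "0 < 2 * u * \<gamma>"
        using \<open>u > 0\<close> \<open>\<gamma> \<ge> 0\<close> by simp
      then have "ennreal (mat_norm2 ?W) \<le> ennreal (1 / (2 * u * \<gamma>))"
        using cond divide_ennreal[of 1 "2 * u * \<gamma>"] by simp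
      then have "mat_norm2 ?W \<le> 1 / (2 * u * \<gamma>)"
        using pos by (subst (asm) ennreal_le_iff) auto
      then show ?thesis
        using pos by (simp add: field_simps)
    qed simp
    have "?W *\<^sub>v ?h = a - a_hat"
      using vandermonde_mat_inverse[OF inj] a a_hat Vdiff
        assoc_mult_mat_vec[OF vandermonde_mat_inverse(1)[OF inj] vandermonde_carrier,
          of "a - a_hat" z]
      by simp
    then have "vec_norm2 (a - a_hat) \<le> mat_norm2 ?W * vec_norm2 ?h"
      using vec_norm2_mult_mat_vec_le[OF vandermonde_mat_inverse(1)[OF inj] h] by simp
    also have "\<dots> \<le> 1 / 2 * vec_norm2 a_hat"
    \<comment> \<open>Multiplying \<open>h_le\<close> by \<open>mat_norm2 ?W\<close> needs a
      nonnegative factor; with a negative one the left-hand side is at most 0 anyway.\<close>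
    proof (cases "0 \<le> mat_norm2 ?W")
      case True
      then have "mat_norm2 ?W * vec_norm2 ?h \<le> mat_norm2 ?W * (u * \<gamma> * vec_norm2 a_hat)"
        using h_le by (rule mult_left_mono[rotated])
      also have "\<dots> = mat_norm2 ?W * (u * \<gamma>) * vec_norm2 a_hat"
        by simp
      also have "\<dots> \<le> 1 / 2 * vec_norm2 a_hat"
        using half by (rule mult_right_mono) simp
      finally show ?thesis .
    next
      case False
      then show ?thesis
        by (auto intro!: order_trans[OF mult_nonpos_nonneg])
    qed
    finally have diff: "vec_norm2 (a - a_hat) \<le> 1 / 2 * vec_norm2 a_hat" .
    \<comment> \<open>The triangle inequality bounds the norm of \<open>a\<close> by 1 + 1/2 = 3/2
      times that of \<open>a_hat\<close>.\<close>
    have lower: "2 / 3 * vec_norm2 a \<le> vec_norm2 a_hat"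
      using vec_norm2_le_add_diff[OF a a_hat] diff by simp
    \<comment> \<open>With the roles exchanged, half the norm of \<open>a_hat\<close> is absorbed on
      the left, which gives the factor 2.\<close>
    have upper: "vec_norm2 a_hat \<le> 2 * vec_norm2 a"
      using vec_norm2_le_add_diff[OF a_hat a] vec_norm2_minus_commute[OF a a_hat] diff by simp
    have "ennreal (u * \<gamma>) * ?\<Lambda> * ennreal (vec_norm2 a_hat)
        \<le> ennreal (u * \<gamma>) * ?\<Lambda> * ennreal (2 * vec_norm2 a)"
      using upper by (intro mult_left_mono ennreal_leI) auto
    also have "\<dots> = ennreal (2 * u * \<gamma>) * ?\<Lambda> * ennreal (vec_norm2 a)"
      using \<open>u > 0\<close> \<open>\<gamma> \<ge> 0\<close> by (simp add: ennreal_mult mult_ac)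
    finally show ?thesis
      using first lower upper by (auto intro: order_trans add_left_mono)
  qed
  show ?thesis
    using first second by blast
qed

end
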